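(* Let $C$ be a nonempty closed convex subset of a real Hilbert space $H$. Assume that the bifunction $f:C\times C\to\mathbb{R}$ satisfies all of the following conditions: (A1) $f$ is monotone on $C$ and $f(x,x)=0$ for all $x\in C$; (A2) $f$ is Lipschitz-type continuous on $C$ with constants $c_1,c_2>0$; (A3) $f$ is weakly continuous on $C\times C$; (A4) $f(x,\cdot)$ is convex and subdifferentiable on $C$ for every fixed $x\in C$. Let $S:C\to C$ be a nonexpansive mapping, and assume in addition that the solution set $EP(f,C)\cap F(S)$ is nonempty. Then the sequences $\{x_n\}$, $\{y_n\}$, $\{z_n\}$ generated by the hybrid algorithm described in the context converge strongly to $P_{EP(f,C)\cap F(S)}(x_0)$.
   Context: Notation: $EP(f,C)=\{x^*\in C: f(x^*,y)\ge 0\ \forall y\in C\}$; $F(S)=\{x\in C: Sx=x\}$; for a nonempty closed convex set $D\subset H$, $P_D:H\to D$ is the metric projection. $S$ is nonexpansive if $\|Sx-Sy\|\le\|x-y\|$ for all $x,y\in C$. Definitions: $f$ is monotone on $C$ if $f(x,y)+f(y,x)\le 0$ for all $x,y\in C$. $f$ is Lipschitz-type continuous on $C$ with constants $c_1,c_2>0$ if $f(x,y)+f(y,z)\ge f(x,z)-c_1\|x-y\|^2-c_2\|y-z\|^2$ for all $x,y,z\in C$. $f$ is weakly continuous on $C\times C$ if $u_n\rightharpoonup u$ and $v_n\rightharpoonup v$ (weakly, with all points in $C$) imply $f(u_n,v_n)\to f(u,v)$. The subdifferential of $g:C\to\mathbb{R}$ at $x\in C$ is $\partial g(x)=\{w\in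 H: g(y)-g(x)\ge\langle w,y-x\rangle\ \forall y\in C\}$; $g$ is subdifferentiable on $C$ if $\partial g(x)\neq\emptyset$ for all $x\in C$. Hybrid algorithm. Initialization: choose $x_0=x_1\in H$, $y_0=y_1\in C$ and set $C_0=Q_0=H$. The parameters satisfy $0<\lambda<\frac{1}{2(c_1+c_2)}$, $k>\frac{1}{1-2\lambda(c_1+c_2)}$, and $\alpha_n\in[0,a]$ for some $a\in(0,1)$. Step 1. Solve the strongly convex program and compute $$y_{n+1}=\operatorname*{argmin}_{y\in C}\Big\{\lambda f(y_n,y)+\tfrac12\|x_n-y\|^2\Big\},\qquad z_{n+1}=\alpha_n y_{n+1}+(1-\alpha_n)Sy_{n+1}.$$ Step 2. Compute $x_{n+1}=P_{\Omega_n}(x_0)$, where $\Omega_n=C_n\cap Q_n$, $$C_n=\{z\in H:\|w_{n+1}-z\|^2\le\|x_n-z\|^2+\epsilon_n\},\qquad Q_n=\{z\in H:\langle x_0-x_n,z-x_n\rangle\le 0\},$$ $$\epsilon_n=k\|x_n-x_{n-1}\|^2+2\lambda c_2\|y_n-y_{n-1}\|^2-\Big(1-\tfrac1k-2\lambda c_1\Big)\|y_{n+1}-y_n\|^2,$$ and $w_{n+1}$ is the element $t\in\{y_{n+1},z_{n+1}\}$ maximizing $\|t-x_n\|$, that is, $w_{n+1}=y_{n+1}$ if $\|y_{n+1}-x_n\|\ge\|z_{n+1}-x_n\|$ and $w_{n+1}=z_{n+1}$ otherwise. Set $n:=n+1$ and go back to Step 1.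
   Formalization: In ε_n the constants c_1 and c_2 are interchanged (2λc_1 on ‖y_n−y_{n−1}‖², 2λc_2 on ‖y_{n+1}−y_n‖²), and the iteration starts at n=0 with C_0=Q_0=H, y_1 being computed by Step 1 instead of set equal to y_0; as printed the claim fails. *)

theory Defs
  imports "HOL-Analysis.Analysis"
begin

(* Weak convergence in a Hilbert space; by Riesz representation the bounded linear functionals
   are exactly the maps v |-> v \<bullet> h. *)
definition weakly_tendsto :: "(nat \<Rightarrow> 'a::real_inner) \<Rightarrow> 'a \<Rightarrow> bool" where
  "weakly_tendsto u l \<longleftrightarrow> (\<forall>h. (\<lambda>n. u n \<bullet> h) \<longlonglongrightarrow> l \<bullet> h)"

(* The library's closest_point has the same form but is restricted to class heine_borel. *)
definition metric_proj :: "'a::real_inner set \<Rightarrow> 'a \<Rightarrow> 'a" where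
  "metric_proj D a = (SOME p. p \<in> D \<and> (\<forall>q\<in>D. dist a p \<le> dist a q))"

definition nonexpansive_on :: "'a::real_inner set \<Rightarrow> ('a \<Rightarrow> 'a) \<Rightarrow> bool" where
  "nonexpansive_on C S \<longleftrightarrow> (\<forall>x\<in>C. \<forall>y\<in>C. norm (S x - S y) \<le> norm (x - y))"

definition fixed_points :: "'a set \<Rightarrow> ('a \<Rightarrow> 'a) \<Rightarrow> 'a set" where
  "fixed_points C S = {x \<in> C. S x = x}"

(* A bifunction on C \<times> C is a total function of which only the values on C \<times> C are ever used. *)
definition EP :: "('a \<Rightarrow> 'a \<Rightarrow> real) \<Rightarrow> 'a set \<Rightarrow> 'a set" where
  "EP f C = {x \<in> C. \<forall>y\<in>C. f x y \<ge> 0}"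

definition monotone_bifun_on :: "'a set \<Rightarrow> ('a \<Rightarrow> 'a \<Rightarrow> real) \<Rightarrow> bool" where
  "monotone_bifun_on C f \<longleftrightarrow> (\<forall>x\<in>C. \<forall>y\<in>C. f x y + f y x \<le> 0)"

definition lipschitz_type_on ::
    "'a::real_inner set \<Rightarrow> ('a \<Rightarrow> 'a \<Rightarrow> real) \<Rightarrow> real \<Rightarrow> real \<Rightarrow> bool" where
  "lipschitz_type_on C f c1 c2 \<longleftrightarrow> (\<forall>x\<in>C. \<forall>y\<in>C. \<forall>z\<in>C.
     f x y + f y z \<ge> f x z - c1 * (norm (x - y))\<^sup>2 - c2 * (norm (y - z))\<^sup>2)"

definition weakly_continuous_on :: "'a::real_inner set \<Rightarrow> ('a \<Rightarrow> 'a \<Rightarrow> real) \<Rightarrow> bool" where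
  "weakly_continuous_on C f \<longleftrightarrow> (\<forall>u v a b.
     (\<forall>n. u n \<in> C) \<and> (\<forall>n. v n \<in> C) \<and> a \<in> C \<and> b \<in> C \<and> weakly_tendsto u a \<and> weakly_tendsto v b
       \<longrightarrow> (\<lambda>n. f (u n) (v n)) \<longlonglongrightarrow> f a b)"

definition subdifferential :: "'a::real_inner set \<Rightarrow> ('a \<Rightarrow> real) \<Rightarrow> 'a \<Rightarrow> 'a set" where
  "subdifferential C g x = {w. \<forall>y\<in>C. g y - g x \<ge> w \<bullet> (y - x)}"

definition subdifferentiable_on :: "'a::real_inner set \<Rightarrow> ('a \<Rightarrow> real) \<Rightarrow> bool" where
  "subdifferentiable_on C g \<longleftrightarrow> (\<forall>x\<in>C. subdifferential C g x \<noteq> {})"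

definition farther_point :: "'a::real_inner \<Rightarrow> 'a \<Rightarrow> 'a \<Rightarrow> 'a" where
  "farther_point x y z = (if norm (y - x) \<ge> norm (z - x) then y else z)"

(* c1 multiplies the older increment y n - y (n - 1) and c2 the newer one y (n + 1) - y n, as
   obtained from lipschitz_type_on at the triple (y (n - 1), y n, y (n + 1)).  With c1 and c2
   interchanged here, the half-spaces below can cut off solutions and the limit can be wrong. *)
definition hybrid_eps ::
    "real \<Rightarrow> real \<Rightarrow> real \<Rightarrow> real \<Rightarrow> (nat \<Rightarrow> 'a::real_inner) \<Rightarrow> (nat \<Rightarrow> 'a) \<Rightarrow> nat \<Rightarrow> real" where
  "hybrid_eps c1 c2 lam k x y n =
     k * (norm (x n - x (n - 1)))\<^sup>2 + 2 * lam * c1 * (norm (y n - y (n - 1)))\<^sup>2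
       - (1 - 1 / k - 2 * lam * c2) * (norm (y (Suc n) - y n))\<^sup>2"

definition hybrid_C ::
    "real \<Rightarrow> real \<Rightarrow> real \<Rightarrow> real \<Rightarrow> (nat \<Rightarrow> 'a::real_inner) \<Rightarrow> (nat \<Rightarrow> 'a) \<Rightarrow> (nat \<Rightarrow> 'a) \<Rightarrow> nat \<Rightarrow> 'a set"
  where
  "hybrid_C c1 c2 lam k x y z n =
     (if n = 0 then UNIV
      else {p. (norm (farther_point (x n) (y (Suc n)) (z (Suc n)) - p))\<^sup>2
                 \<le> (norm (x n - p))\<^sup>2 + hybrid_eps c1 c2 lam k x y n})"

definition hybrid_Q :: "(nat \<Rightarrow> 'a::real_inner) \<Rightarrow> nat \<Rightarrow> 'a set" where
  "hybrid_Q x n = (if n = 0 then UNIV else {p. (x 0 - x n) \<bullet> (p - x n) \<le> 0})"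

(* The sequences generated from x 0 and y 0 \<in> C.  The first pass is n = 0, with both constraint
   sets equal to the whole space: it yields y 1 and z 1 by the general rule and x 1 = x 0
   (stated separately, although it already follows).  The term z 0 is never used.
   The minimiser and the projections are the values of choice functions, so no well-posedness
   of the individual steps is assumed. *)
definition hybrid_algorithm ::
    "'a::real_inner set \<Rightarrow> ('a \<Rightarrow> 'a \<Rightarrow> real) \<Rightarrow> ('a \<Rightarrow> 'a) \<Rightarrow> real \<Rightarrow> real \<Rightarrow> real \<Rightarrow> real \<Rightarrow> (nat \<Rightarrow> real)
      \<Rightarrow> (nat \<Rightarrow> 'a) \<Rightarrow> (nat \<Rightarrow> 'a) \<Rightarrow> (nat \<Rightarrow> 'a) \<Rightarrow> bool" where
  "hybrid_algorithm C f S c1 c2 lam k \<alpha> x y z \<longleftrightarrow>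
     x 1 = x 0 \<and> y 0 \<in> C \<and>
     (\<forall>n. y (Suc n) = arg_min_on (\<lambda>v. lam * f (y n) v + 1 / 2 * (norm (x n - v))\<^sup>2) C \<and>
          z (Suc n) = \<alpha> n *\<^sub>R y (Suc n) + (1 - \<alpha> n) *\<^sub>R S (y (Suc n)) \<and>
          x (Suc n) = metric_proj (hybrid_C c1 c2 lam k x y z n \<inter> hybrid_Q x n) (x 0))"

end

theory Submission
  imports Defs
begin

text \<open>
  Write \<open>Sol\<close> for the set of common solutions.  Each half-space \<open>C\<^sub>n\<close> contains \<open>Sol\<close>: adding the
  variational inequalities of two consecutive proximal steps to the Lipschitz-type and monotonicity
  conditions bounds \<open>\<parallel>y\<^sub>n\<^sub>+\<^sub>1 - p\<parallel>\<^sup>2\<close> by \<open>\<parallel>x\<^sub>n - p\<parallel>\<^sup>2 + \<epsilon>\<^sub>n\<close> for a solution \<open>p\<close> (\<open>y_step_solution\<close>).  By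
  induction \<open>Sol\<close> lies in each \<open>Q\<^sub>n\<close> as well, because \<open>Q\<^sub>n\<^sub>+\<^sub>1\<close> is the supporting half-space at the
  projection \<open>x\<^sub>n\<^sub>+\<^sub>1\<close>.  Since \<open>x\<^sub>n\<close> is the projection of \<open>x\<^sub>0\<close> onto \<open>Q\<^sub>n\<close>, this gives
  \<open>\<parallel>q - x\<^sub>n\<parallel>\<^sup>2 \<le> \<parallel>q - x\<^sub>0\<parallel>\<^sup>2 - \<parallel>x\<^sub>n - x\<^sub>0\<parallel>\<^sup>2\<close> both for \<open>q = x\<^sub>n\<^sub>+\<^sub>1\<close> and for \<open>q \<in> Sol\<close>.

  The first choice makes \<open>\<parallel>x\<^sub>n - x\<^sub>0\<parallel>\<close> increase to some limit \<open>d\<close> and \<open>x\<^sub>n\<^sub>+\<^sub>1 - x\<^sub>n\<close> tend to zero.  That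
  \<open>x\<^sub>n\<^sub>+\<^sub>1\<close> belongs to \<open>C\<^sub>n\<close> implies that \<open>\<parallel>x\<^sub>n\<^sub>+\<^sub>1 - x\<^sub>n\<parallel>\<^sup>2 + \<epsilon>\<^sub>n\<close> is nonnegative, which is a contractive
  recursion, perturbed by a null sequence, for \<open>\<parallel>y\<^sub>n\<^sub>+\<^sub>1 - y\<^sub>n\<parallel>\<^sup>2\<close>; the choice of \<open>k\<close> makes its factor
  less than one.  Hence the increments of \<open>y\<close> tend to zero, and with them \<open>\<epsilon>\<^sub>n\<close>, \<open>y\<^sub>n - x\<^sub>n\<close>,
  \<open>z\<^sub>n - x\<^sub>n\<close> and \<open>y\<^sub>n - S y\<^sub>n\<close>.

  The second choice shows that strong convergence follows once there is a \<open>p \<in> Sol\<close> with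
  \<open>\<parallel>p - x\<^sub>0\<parallel> \<le> d\<close>.  Rather than as a weak cluster point, \<open>p\<close> is found as a common point of the closed
  convex hulls of all tails of \<open>y\<close> (\<open>tail_hulls_common_point\<close>): asymptotic upper bounds along \<open>y\<close> on
  continuous convex functions pass to such a point (\<open>tail_hulls_convex_bound\<close>).  To be a solution is
  a condition of this kind by Minty's trick, which evaluates the bifunction or the displacement
  \<open>v - S v\<close> at a fixed test point \<open>v\<close>, so that the iterate appears only as the argument of a convex
  function: \<open>p \<in> Sol\<close> follows from \<open>f v p \<le> 0\<close> and \<open>(v - S v) \<bullet> (p - v) \<le> 0\<close> for all \<open>v \<in> C\<close>
  (\<open>EP_MintyI\<close>, \<open>fixed_points_MintyI\<close>).
\<close>

section \<open>Proximal points and metric projections\<close>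

text \<open>
  By the parallelogram law, adding half the squared distance to a convex function makes it so
  strongly convex that its near-minimisers are close together; completeness turns their nested
  sublevel sets into a single point.  The affine minorant keeps the infimum finite.
\<close>

lemma proximal_point_exists:
  fixes C :: "'a::{real_inner, complete_space} set" and g :: "'a \<Rightarrow> real"
  assumes C: "C \<noteq> {}" "closed C" "convex C"
    and g: "convex_on C g" "continuous_on C g"
    and minorant: "\<And>v. v \<in> C \<Longrightarrow> b + w \<bullet> v \<le> g v"
  shows "\<exists>m. m \<in> C \<and> (\<forall>v\<in>C. g m + 1 / 2 * (norm (a - m))\<^sup>2 \<le> g v + 1 / 2 * (norm (a - v))\<^sup>2)"
proof -
  define h where "h v = g v + 1 / 2 * (norm (a - v))\<^sup>2" for v
  define I where "I = (INF v\<in>C. h v)"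
  have "b + w \<bullet> a - (norm w)\<^sup>2 / 2 \<le> h v" if "v \<in> C" for v
  proof -
    \<comment> \<open>Complete the square in the sum of the affine minorant and the quadratic term.\<close>
    have "b + w \<bullet> a - (norm w)\<^sup>2 / 2 + (norm (v - a + w))\<^sup>2 / 2
        = b + w \<bullet> v + 1 / 2 * (norm (a - v))\<^sup>2"
      by (simp add: power2_norm_eq_inner inner_simps inner_commute field_simps)
    with minorant[OF that] show ?thesis
      unfolding h_def using zero_le_power2[of "norm (v - a + w)"] by linarith
  qed
  then have bdd: "bdd_below (h ` C)"
    by (intro bdd_belowI2)
  have I_le: "I \<le> h v" if "v \<in> C" for v
    unfolding I_def using bdd that by (rule cINF_lower)
  have gap: "(norm (u - v))\<^sup>2 \<le> 4 * (h u + h v - 2 * I)" if "u \<in> C" "v \<in> C" for u v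
  proof -
    define c where "c = (1 / 2) *\<^sub>R u + (1 / 2) *\<^sub>R v"
    have "c \<in> C"
      unfolding c_def using C(3) that by (intro convexD) auto
    then have "I \<le> h c"
      by (rule I_le)
    moreover have "g c \<le> 1 / 2 * g u + 1 / 2 * g v"
      unfolding c_def using convex_onD[OF g(1), of "1 / 2" u v] that by simp
    moreover have "1 / 2 * (norm (a - c))\<^sup>2
        = 1 / 4 * (norm (a - u))\<^sup>2 + 1 / 4 * (norm (a - v))\<^sup>2 - 1 / 8 * (norm (u - v))\<^sup>2"
      unfolding c_def
      by (simp add: power2_norm_eq_inner inner_simps inner_commute field_simps)
    ultimately show ?thesis
      unfolding h_def by (simp add: field_simps)
  qed
  define K where "K n = {v \<in> C. h v \<le> I + inverse (real (Suc n))}" for n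
  obtain m where m: "\<And>n. m \<in> K n"
  proof (rule decreasing_closed_nest)
    have "continuous_on C h"
      unfolding h_def by (intro continuous_intros g(2))
    then show "closed (K n)" for n
      unfolding K_def using C(2) by (intro continuous_on_closed_Collect_le) auto
    show "K n \<noteq> {}" for n
    proof -
      have "\<exists>v\<in>C. h v < I + inverse (real (Suc n))"
        using cINF_less_iff[OF C(1) bdd, of "I + inverse (real (Suc n))"] unfolding I_def by simp
      then show ?thesis
        unfolding K_def by force
    qed
    show "K n \<subseteq> K m" if "m \<le> n" for m n
    proof -
      have "I + inverse (real (Suc n)) \<le> I + inverse (real (Suc m))"
        using that by (intro add_left_mono le_imp_inverse_le) auto
      then show ?thesis
        unfolding K_def by (blast intro: order_trans)
    qed
    show "\<exists>n. \<forall>u\<in>K n. \<forall>v\<in>K n. dist u v < e" if "e > 0" for e :: real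
    proof -
      have "0 < e\<^sup>2 / 8"
        using that by simp
      then obtain n where n: "inverse (real (Suc n)) < e\<^sup>2 / 8"
        by (rule reals_Archimedean[THEN exE])
      have "dist u v < e" if "u \<in> K n" "v \<in> K n" for u v
      proof (rule power_less_imp_less_base[of _ 2])
        show "(dist u v)\<^sup>2 < e\<^sup>2"
          using gap[of u v] that n unfolding K_def dist_norm by auto
      qed (use \<open>e > 0\<close> in auto)
      then show ?thesis
        by blast
    qed
  qed blast
  have "h m \<le> I"
  proof (rule LIMSEQ_le_const)
    show "(\<lambda>n. I + inverse (real (Suc n))) \<longlonglongrightarrow> I"
      using tendsto_add[OF tendsto_const LIMSEQ_inverse_real_of_nat, of I] by simp
  qed (use m in \<open>auto simp: K_def\<close>)
  then show ?thesis
    using m[of 0] I_le unfolding K_def h_def by fastforce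
qed

text \<open>
  The first-order condition: compare \<open>m\<close> with the point at parameter \<open>t\<close> of the segment from \<open>m\<close> to
  \<open>v\<close>, divide by \<open>t\<close> and let \<open>t\<close> tend to zero.
\<close>

lemma proximal_point_variational:
  fixes C :: "'a::real_inner set"
  assumes C: "convex C" and g: "convex_on C g" and m: "m \<in> C"
    and min: "\<And>v. v \<in> C \<Longrightarrow> g m + 1 / 2 * (norm (a - m))\<^sup>2 \<le> g v + 1 / 2 * (norm (a - v))\<^sup>2"
    and v: "v \<in> C"
  shows "(a - m) \<bullet> (v - m) \<le> g v - g m"
proof -
  have ineq: "(a - m) \<bullet> (v - m) \<le> g v - g m + t / 2 * (norm (v - m))\<^sup>2" if t: "0 < t" "t < 1" for t
  proof -
    define c where "c = (1 - t) *\<^sub>R m + t *\<^sub>R v"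
    have "c \<in> C"
      unfolding c_def using C m v t by (intro convexD) auto
    moreover have "g c \<le> (1 - t) * g m + t * g v"
      unfolding c_def using convex_onD[OF g, of t m v] m v t by simp
    moreover have "1 / 2 * (norm (a - c))\<^sup>2
        = 1 / 2 * (norm (a - m))\<^sup>2 - t * ((a - m) \<bullet> (v - m)) + t * (t / 2 * (norm (v - m))\<^sup>2)"
    proof -
      have c: "a - c = (a - m) - t *\<^sub>R (v - m)"
        unfolding c_def by (simp add: algebra_simps)
      show ?thesis
        unfolding c power2_norm_eq_inner
        by (simp add: inner_diff_left inner_diff_right inner_commute algebra_simps)
    qed
    ultimately have "t * ((a - m) \<bullet> (v - m)) \<le> t * (g v - g m + t / 2 * (norm (v - m))\<^sup>2)"
      using min[of c] by (simp add: algebra_simps)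
    then show ?thesis
      using t by simp
  qed
  have "((\<lambda>t. g v - g m + t / 2 * (norm (v - m))\<^sup>2) \<longlongrightarrow> g v - g m + 0 / 2 * (norm (v - m))\<^sup>2)
      (at_right 0)"
    by (intro tendsto_intros) simp
  moreover have "eventually (\<lambda>t::real. 0 < t \<and> t < 1) (at_right 0)"
    by (auto simp: eventually_at_right_field intro: exI[of _ 1])
  then have "\<forall>\<^sub>F t in at_right 0. (a - m) \<bullet> (v - m) \<le> g v - g m + t / 2 * (norm (v - m))\<^sup>2"
    by eventually_elim (use ineq in blast)
  ultimately show ?thesis
    using tendsto_lowerbound[of _ _ "at_right (0::real)"] by fastforce
qed

text \<open>
  The inner product hypothesis says that the angle at \<open>p\<close> between \<open>a\<close> and \<open>q\<close> is not acute, so this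
  is Pythagoras with the inequality that such an angle gives.
\<close>

lemma dist_power2_variational:
  fixes a p q :: "'a::real_inner"
  assumes "(a - p) \<bullet> (q - p) \<le> 0"
  shows "(norm (q - p))\<^sup>2 \<le> (norm (q - a))\<^sup>2 - (norm (p - a))\<^sup>2"
proof -
  have "(norm (q - a))\<^sup>2 = (norm (p - a))\<^sup>2 - 2 * ((a - p) \<bullet> (q - p)) + (norm (q - p))\<^sup>2"
    by (simp add: power2_norm_eq_inner inner_simps inner_commute algebra_simps)
  with assms show ?thesis
    by linarith
qed

lemma metric_proj_eqI:
  assumes p: "p \<in> D" and var: "\<And>q. q \<in> D \<Longrightarrow> (a - p) \<bullet> (q - p) \<le> 0"
  shows "metric_proj D a = p"
  unfolding metric_proj_def
proof (rule some_equality)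
  have "dist a p \<le> dist a q" if "q \<in> D" for q
  proof (rule power2_le_imp_le)
    show "(dist a p)\<^sup>2 \<le> (dist a q)\<^sup>2"
      using dist_power2_variational[OF var[OF that]] zero_le_power2[of "norm (q - p)"]
      unfolding dist_norm norm_minus_commute[of a] by linarith
  qed simp
  with p show "p \<in> D \<and> (\<forall>q\<in>D. dist a p \<le> dist a q)"
    by blast
next
  fix m assume m: "m \<in> D \<and> (\<forall>q\<in>D. dist a m \<le> dist a q)"
  then have "(norm (m - a))\<^sup>2 \<le> (norm (p - a))\<^sup>2"
    using p by (intro power_mono) (auto simp: dist_norm norm_minus_commute)
  then have "(norm (m - p))\<^sup>2 \<le> 0"
    using dist_power2_variational[OF var[of m]] m by linarith
  then show "m = p"
    by simp
qed

text \<open>The metric projection is the proximal point of the zero function.\<close>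

lemma metric_proj_closed_convex:
  fixes D :: "'a::{real_inner, complete_space} set"
  assumes D: "D \<noteq> {}" "closed D" "convex D"
  shows metric_proj_in: "metric_proj D a \<in> D"
    and metric_proj_variational: "q \<in> D \<Longrightarrow> (a - metric_proj D a) \<bullet> (q - metric_proj D a) \<le> 0"
proof -
  have const: "convex_on D (\<lambda>_. 0 :: real)"
    using D(3) by (simp add: convex_on_def)
  obtain m where m: "m \<in> D" "\<And>v. v \<in> D \<Longrightarrow> 0 + 1 / 2 * (norm (a - m))\<^sup>2 \<le> 0 + 1 / 2 * (norm (a - v))\<^sup>2"
    using proximal_point_exists[OF D const, of 0 0 a] by auto
  have var: "(a - m) \<bullet> (q - m) \<le> 0" if "q \<in> D" for q
    using proximal_point_variational[OF D(3) const m that] by simp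
  have "metric_proj D a = m"
    using m(1) var by (rule metric_proj_eqI)
  then show "metric_proj D a \<in> D" "q \<in> D \<Longrightarrow> (a - metric_proj D a) \<bullet> (q - metric_proj D a) \<le> 0"
    using m(1) var by simp_all
qed

section \<open>Points in the closed convex hulls of all tails\<close>

text \<open>
  The points of least norm of a decreasing sequence of closed convex sets have increasing norms, and
  the obtuse angle inequality bounds their mutual distances by the growth of the squared norms; so
  they converge once the norms are bounded.  For the tail hulls of a bounded sequence the common
  point found here serves as a substitute for a weak cluster point.
\<close>

lemma tail_hulls_common_point:
  fixes u :: "nat \<Rightarrow> 'a::{real_inner, complete_space}"
  assumes bdd: "bounded (range u)"
  shows "\<exists>p. \<forall>n. p \<in> closure (convex hull (u ` {n..}))"
proof -
  define K where "K n = closure (convex hull (u ` {n..}))" for n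
  have K: "K n \<noteq> {}" "closed (K n)" "convex (K n)" for n
    unfolding K_def by (auto simp: convex_closure convex_convex_hull)
  have anti: "K n \<subseteq> K m" if "m \<le> n" for m n
    unfolding K_def using that by (intro closure_mono hull_mono image_mono) auto
  have u_in: "u n \<in> K n" for n
    unfolding K_def using hull_inc[of "u n" "u ` {n..}"] closure_subset by fastforce
  define P where "P n = metric_proj (K n) 0" for n
  have P_in: "P n \<in> K n" for n
    unfolding P_def using K by (rule metric_proj_in)
  have P_dist: "(norm (q - P n))\<^sup>2 \<le> (norm q)\<^sup>2 - (norm (P n))\<^sup>2" if "q \<in> K n" for q n
    using dist_power2_variational[OF metric_proj_variational[OF K that, of 0]] unfolding P_def by simp
  define s where "s n = (norm (P n))\<^sup>2" for n
  have P_gap: "(norm (P m - P n))\<^sup>2 \<le> s m - s n" if "n \<le> m" for m n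
    using P_dist[of "P m" n] P_in[of m] anti[OF that] unfolding s_def by blast
  obtain B where B: "\<And>n. norm (u n) \<le> B"
    using bdd by (auto simp: bounded_iff)
  have "s n \<le> B\<^sup>2" for n
    using P_dist[OF u_in, of n] zero_le_power2[of "norm (u n - P n)"] power_mono[OF B[of n] norm_ge_zero, of 2]
    unfolding s_def by linarith
  moreover have "incseq s"
  proof (rule incseq_SucI)
    show "s n \<le> s (Suc n)" for n
      using P_gap[of n "Suc n"] zero_le_power2[of "norm (P (Suc n) - P n)"] by linarith
  qed
  ultimately have "Cauchy s"
    by (meson incseq_convergent convergentI convergent_Cauchy)
  have "Cauchy P"
  proof (rule CauchyI')
    fix e :: real assume e: "e > 0"
    obtain M where M: "\<And>m n. m \<ge> M \<Longrightarrow> n \<ge> M \<Longrightarrow> norm (s m - s n) < e\<^sup>2"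
      using CauchyD[OF \<open>Cauchy s\<close>, of "e\<^sup>2"] e by auto
    have "dist (P m) (P n) < e" if "m \<ge> M" "n > m" for m n
    proof (rule power_less_imp_less_base[of _ 2])
      show "(dist (P m) (P n))\<^sup>2 < e\<^sup>2"
        using P_gap[of m n] M[of n m] that by (simp add: dist_norm norm_minus_commute)
    qed (use e in auto)
    then show "\<exists>M. \<forall>m\<ge>M. \<forall>n>m. dist (P m) (P n) < e"
      by blast
  qed
  then obtain p where p: "P \<longlonglongrightarrow> p"
    using Cauchy_convergent convergent_def by blast
  have "p \<in> K n" for n
  proof (rule Lim_in_closed_set[OF K(2) _ _ p])
    show "\<forall>\<^sub>F m in sequentially. P m \<in> K n"
      using eventually_ge_at_top[of n] by eventually_elim (use P_in anti in blast)
  qed simp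
  then show ?thesis
    unfolding K_def by blast
qed

lemma tail_hulls_in:
  assumes p: "\<And>n. p \<in> closure (convex hull (u ` {n..}))"
    and D: "closed D" "convex D" and u: "\<And>m. n \<le> m \<Longrightarrow> u m \<in> D"
  shows "p \<in> D"
proof -
  have "closure (convex hull (u ` {n..})) \<subseteq> D"
    using D u by (intro closure_minimal hull_minimal) auto
  with p show ?thesis
    by blast
qed

text \<open>
  The sublevel set at \<open>c + e\<close> is closed and convex and contains a tail of \<open>u\<close>.
\<close>

lemma tail_hulls_convex_bound:
  fixes u :: "nat \<Rightarrow> 'a::real_normed_vector" and g :: "'a \<Rightarrow> real"
  assumes p: "\<And>n. p \<in> closure (convex hull (u ` {n..}))"
    and C: "closed C" and u: "\<And>n. u n \<in> C"
    and g: "convex_on C g" "continuous_on C g"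
    and le: "\<forall>\<^sub>F n in sequentially. g (u n) \<le> t n" and t: "t \<longlonglongrightarrow> c"
  shows "g p \<le> c"
proof -
  have "g p \<le> c + e" if "e > 0" for e
  proof -
    have "\<forall>\<^sub>F n in sequentially. t n < c + e"
      using order_tendstoD(2)[OF t] that by simp
    with le have "\<forall>\<^sub>F n in sequentially. g (u n) \<le> c + e"
      by eventually_elim simp
    then obtain N where N: "\<And>n. N \<le> n \<Longrightarrow> g (u n) \<le> c + e"
      by (auto simp: eventually_sequentially)
    have "p \<in> {v \<in> C. g v \<le> c + e}"
    proof (rule tail_hulls_in[OF p])
      show "closed {v \<in> C. g v \<le> c + e}"
        using C g(2) by (intro continuous_on_closed_Collect_le) auto
      show "convex {v \<in> C. g v \<le> c + e}"
      proof (rule convexI)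
        fix v w and r s :: real
        assume vw: "v \<in> {v \<in> C. g v \<le> c + e}" "w \<in> {v \<in> C. g v \<le> c + e}"
          and rs: "0 \<le> r" "0 \<le> s" "r + s = 1"
        have "g (r *\<^sub>R v + s *\<^sub>R w) \<le> r * g v + s * g w"
          using g(1) vw rs unfolding convex_on_def by blast
        also have "\<dots> \<le> c + e"
          using vw rs by (intro convex_bound_le) auto
        finally show "r *\<^sub>R v + s *\<^sub>R w \<in> {v \<in> C. g v \<le> c + e}"
          using vw rs convexD[OF convex_on_imp_convex[OF g(1)]] by simp
      qed
      show "u m \<in> {v \<in> C. g v \<le> c + e}" if "N \<le> m" for m
        using u N that by simp
    qed
    then show ?thesis
      by simp
  qed
  then show "g p \<le> c"
    by (rule field_le_epsilon)
qed

section \<open>Minty's characterisations\<close>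

lemma weakly_tendsto_LIMSEQ:
  assumes "u \<longlonglongrightarrow> l"
  shows "weakly_tendsto u l"
  unfolding weakly_tendsto_def using assms by (intro allI tendsto_intros)

lemma weakly_continuous_on_LIMSEQ:
  assumes "weakly_continuous_on C f"
    and "\<And>n. u n \<in> C" "\<And>n. v n \<in> C" "a \<in> C" "b \<in> C" "u \<longlonglongrightarrow> a" "v \<longlonglongrightarrow> b"
  shows "(\<lambda>n. f (u n) (v n)) \<longlonglongrightarrow> f a b"
  using assms unfolding weakly_continuous_on_def by (meson weakly_tendsto_LIMSEQ)

lemma weakly_continuous_on_continuous:
  assumes "weakly_continuous_on C f" "v \<in> C"
  shows "continuous_on C (f v)"
  unfolding continuous_on_sequentially
  using weakly_continuous_on_LIMSEQ[OF assms(1), of "\<lambda>_. v"] assms(2) by (auto simp: o_def)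

lemma segment_sequence:
  fixes p v :: "'a::real_normed_vector"
  assumes C: "convex C" "p \<in> C" "v \<in> C"
  defines "s \<equiv> \<lambda>n. p + inverse (real (Suc n)) *\<^sub>R (v - p)"
  shows "s n \<in> C" "s \<longlonglongrightarrow> p"
proof -
  have "s n = (1 - inverse (real (Suc n))) *\<^sub>R p + inverse (real (Suc n)) *\<^sub>R v"
    unfolding s_def by (simp add: algebra_simps)
  also have "\<dots> \<in> C"
    using C by (intro convexD) (auto simp: field_simps)
  finally show "s n \<in> C" .
  have "s \<longlonglongrightarrow> p + 0 *\<^sub>R (v - p)"
    unfolding s_def by (intro tendsto_intros LIMSEQ_inverse_real_of_nat)
  then show "s \<longlonglongrightarrow> p"
    by simp
qed

text \<open>
  At a point \<open>s\<close> of the segment from \<open>p\<close> to \<open>v\<close>, convexity bounds \<open>0 = f s s\<close> by a weighted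
  mean of \<open>f s p \<le> 0\<close> and \<open>f s v\<close>, which forces \<open>0 \<le> f s v\<close>; then let \<open>s\<close> tend to \<open>p\<close>.
\<close>

lemma EP_MintyI:
  fixes C :: "'a::real_inner set"
  assumes C: "convex C" and p: "p \<in> C"
    and diag: "\<forall>v\<in>C. f v v = 0" and conv: "\<And>v. v \<in> C \<Longrightarrow> convex_on C (f v)"
    and cont: "weakly_continuous_on C f"
    and dual: "\<And>v. v \<in> C \<Longrightarrow> f v p \<le> 0"
  shows "p \<in> EP f C"
proof -
  have "0 \<le> f p v" if v: "v \<in> C" for v
  proof -
    define s where "s n = p + inverse (real (Suc n)) *\<^sub>R (v - p)" for n
    have s: "s n \<in> C" "s \<longlonglongrightarrow> p" for n
      using segment_sequence[OF C p v] unfolding s_def by auto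
    have "0 \<le> f (s n) v" for n
    proof -
      define r where "r = inverse (real (Suc n))"
      have r: "0 < r" "r \<le> 1"
        unfolding r_def by (auto simp: field_simps)
      have "s n = (1 - r) *\<^sub>R p + r *\<^sub>R v"
        unfolding s_def r_def by (simp add: algebra_simps)
      then have "f (s n) (s n) \<le> (1 - r) * f (s n) p + r * f (s n) v"
        using convex_onD[OF conv[OF s(1)[of n]], of r p v] p v r by simp
      moreover have "(1 - r) * f (s n) p \<le> 0"
        using dual[OF s(1)] r by (simp add: mult_nonneg_nonpos)
      ultimately have "0 \<le> r * f (s n) v"
        using diag s(1) by simp
      then show ?thesis
        using r by (simp add: zero_le_mult_iff)
    qed
    moreover have "(\<lambda>n. f (s n) v) \<longlonglongrightarrow> f p v"
      using weakly_continuous_on_LIMSEQ[OF cont, of s "\<lambda>_. v"] s p v by simp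
    ultimately show ?thesis
      by (meson LIMSEQ_le_const)
  qed
  with p show ?thesis
    unfolding EP_def by blast
qed

lemma nonexpansive_on_continuous:
  assumes "nonexpansive_on C S"
  shows "continuous_on C S"
proof (rule lipschitz_on_continuous_on)
  show "1-lipschitz_on C S"
    using assms by (intro lipschitz_onI) (auto simp: nonexpansive_on_def dist_norm)
qed

lemma nonexpansive_on_monotone_displacement:
  assumes "nonexpansive_on C S" "u \<in> C" "v \<in> C"
  shows "(u - S u) \<bullet> (v - u) \<le> (v - S v) \<bullet> (v - u)"
proof -
  have "(S v - S u) \<bullet> (v - u) \<le> norm (S v - S u) * norm (v - u)"
    by (rule norm_cauchy_schwarz)
  also have "\<dots> \<le> norm (v - u) * norm (v - u)"
    using assms unfolding nonexpansive_on_def by (intro mult_right_mono) auto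
  also have "\<dots> = (v - u) \<bullet> (v - u)"
    by (simp add: norm_eq_sqrt_inner)
  finally show ?thesis
    by (simp add: inner_diff_left inner_diff_right)
qed

text \<open>
  Testing with points that run from \<open>S p\<close> towards \<open>p\<close> yields \<open>0 \<le> (p - S p) \<bullet> (S p - p)\<close> in the
  limit, and this inner product is minus a square.
\<close>

lemma fixed_points_MintyI:
  fixes C :: "'a::real_inner set"
  assumes C: "convex C" and p: "p \<in> C" and S: "S \<in> C \<rightarrow> C" "nonexpansive_on C S"
    and dual: "\<And>v. v \<in> C \<Longrightarrow> 0 \<le> (v - S v) \<bullet> (v - p)"
  shows "p \<in> fixed_points C S"
proof -
  have Sp: "S p \<in> C"
    using S(1) p by blast
  define s where "s n = p + inverse (real (Suc n)) *\<^sub>R (S p - p)" for n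
  have s: "s n \<in> C" "s \<longlonglongrightarrow> p" for n
    using segment_sequence[OF C p Sp] unfolding s_def by auto
  have "0 \<le> (s n - S (s n)) \<bullet> (S p - p)" for n
    using dual[OF s(1)[of n]] unfolding s_def by (simp add: zero_le_mult_iff del: of_nat_Suc)
  moreover have "(\<lambda>n. S (s n)) \<longlonglongrightarrow> S p"
    using nonexpansive_on_continuous[OF S(2)] s p unfolding continuous_on_sequentially o_def by blast
  then have "(\<lambda>n. (s n - S (s n)) \<bullet> (S p - p)) \<longlonglongrightarrow> (p - S p) \<bullet> (S p - p)"
    by (intro tendsto_intros s(2))
  ultimately have "0 \<le> (p - S p) \<bullet> (S p - p)"
    by (meson LIMSEQ_le_const)
  also have "(p - S p) \<bullet> (S p - p) = - ((S p - p) \<bullet> (S p - p))"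
    by (simp add: inner_diff_left)
  finally have "(S p - p) \<bullet> (S p - p) \<le> 0"
    by simp
  then have "S p = p"
    by (metis inner_gt_zero_iff not_le right_minus_eq)
  with p show ?thesis
    unfolding fixed_points_def by blast
qed


section \<open>Null sequences and an elementary estimate\<close>

text \<open>
  Once \<open>d\<close> stays below \<open>(1 - r) * (e / 2)\<close>, the recursion is dominated by an affine one with
  fixed point \<open>e / 2\<close>, and the excess of \<open>A\<close> over that point decays geometrically.
\<close>

lemma perturbed_contraction_tendsto_zero:
  fixes A d :: "nat \<Rightarrow> real"
  assumes A: "\<And>n. 0 \<le> A n" and r: "0 \<le> r" "r < 1"
    and step: "\<And>n. A (Suc n) \<le> r * A n + d n" and d: "d \<longlonglongrightarrow> 0"
  shows "A \<longlonglongrightarrow> 0"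
proof (rule LIMSEQ_I)
  fix e :: real assume e: "e > 0"
  have "0 < (1 - r) * (e / 2)"
    using e r by simp
  then have "\<forall>\<^sub>F n in sequentially. d n < (1 - r) * (e / 2)"
    by (rule order_tendstoD(2)[OF d])
  then obtain N where N: "\<And>n. n \<ge> N \<Longrightarrow> d n < (1 - r) * (e / 2)"
    by (auto simp: eventually_sequentially)
  have geometric: "A (N + j) \<le> r ^ j * A N + e / 2" for j
  proof (induction j)
    case 0
    then show ?case
      using e by simp
  next
    case (Suc j)
    have "A (N + Suc j) \<le> r * A (N + j) + (1 - r) * (e / 2)"
      using step[of "N + j"] N[of "N + j"] by simp
    also have "\<dots> \<le> r * (r ^ j * A N + e / 2) + (1 - r) * (e / 2)"
      using mult_left_mono[OF Suc.IH r(1)] by simp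
    also have "\<dots> = r ^ Suc j * A N + e / 2"
      by (simp add: field_simps)
    finally show ?case .
  qed
  have "(\<lambda>j. r ^ j * A N) \<longlonglongrightarrow> 0 * A N"
    using r by (intro tendsto_intros LIMSEQ_realpow_zero) auto
  then have "\<forall>\<^sub>F j in sequentially. r ^ j * A N < e / 2"
    by (rule order_tendstoD(2)) (use e in simp)
  then obtain M where M: "\<And>j. j \<ge> M \<Longrightarrow> r ^ j * A N < e / 2"
    by (auto simp: eventually_sequentially)
  have "norm (A n - 0) < e" if "n \<ge> N + M" for n
  proof -
    have "M \<le> n - N" "N + (n - N) = n"
      using that by auto
    with geometric[of "n - N"] M[of "n - N"] A[of n] show ?thesis
      by simp
  qed
  then show "\<exists>no. \<forall>n\<ge>no. norm (A n - 0) < e"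
    by blast
qed

lemma tendsto_zero_norm_power2:
  fixes u :: "'b \<Rightarrow> 'a::real_normed_vector"
  shows "((\<lambda>n. (norm (u n))\<^sup>2) \<longlongrightarrow> 0) F \<longleftrightarrow> (u \<longlongrightarrow> 0) F"
  by (simp add: power_tendsto_0_iff tendsto_norm_zero_iff)

lemma tendsto_zero_norm_le:
  fixes u :: "nat \<Rightarrow> 'a::real_normed_vector"
  assumes "g \<longlonglongrightarrow> 0" "\<And>n. norm (u n) \<le> g n"
  shows "u \<longlonglongrightarrow> 0"
  using assms(2) by (intro Lim_null_comparison[OF always_eventually assms(1)]) blast

lemma tendsto_zero_norm_power2_le:
  fixes u :: "nat \<Rightarrow> 'a::real_normed_vector"
  assumes "g \<longlonglongrightarrow> 0" "\<And>n. (norm (u n))\<^sup>2 \<le> g n"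
  shows "u \<longlonglongrightarrow> 0"
proof -
  have "(\<lambda>n. (norm (u n))\<^sup>2) \<longlonglongrightarrow> 0"
    by (rule tendsto_zero_norm_le[OF assms(1)]) (simp add: assms(2))
  then show ?thesis
    by (simp only: tendsto_zero_norm_power2)
qed

lemma tendsto_zero_inner_bounded:
  fixes u v :: "nat \<Rightarrow> 'a::real_inner"
  assumes u: "u \<longlonglongrightarrow> 0" and v: "bounded (range v)"
  shows "(\<lambda>n. u n \<bullet> v n) \<longlonglongrightarrow> 0"
proof -
  obtain B where B: "\<And>n. norm (v n) \<le> B"
    using v by (auto simp: bounded_iff)
  have "(\<lambda>n. norm (u n) * B) \<longlonglongrightarrow> 0 * B"
    by (intro tendsto_intros tendsto_norm_zero u)
  moreover have "norm (u n \<bullet> v n) \<le> norm (u n) * B" for n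
  proof -
    have "norm (u n \<bullet> v n) \<le> norm (u n) * norm (v n)"
      by (simp add: Cauchy_Schwarz_ineq2)
    also have "\<dots> \<le> norm (u n) * B"
      using B by (intro mult_left_mono) auto
    finally show ?thesis .
  qed
  ultimately show ?thesis
    using tendsto_zero_norm_le[of "\<lambda>n. norm (u n) * B" "\<lambda>n. u n \<bullet> v n"] by simp
qed

lemma inner_Young:
  fixes u v :: "'a::real_inner"
  assumes k: "k > 0"
  shows "2 * (u \<bullet> v) \<le> k * (norm u)\<^sup>2 + 1 / k * (norm v)\<^sup>2"
proof -
  have "0 \<le> (norm (k *\<^sub>R u - v))\<^sup>2"
    by simp
  also have "\<dots> = k * (k * (norm u)\<^sup>2) - k * (2 * (u \<bullet> v)) + (norm v)\<^sup>2"
    unfolding power2_norm_eq_inner by (simp add: inner_diff_left inner_diff_right inner_commute)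
  also have "\<dots> = k * (k * (norm u)\<^sup>2 + 1 / k * (norm v)\<^sup>2 - 2 * (u \<bullet> v))"
    using k by (simp add: algebra_simps)
  finally show ?thesis
    using k by (simp add: zero_le_mult_iff)
qed

section \<open>The hybrid algorithm\<close>

locale hybrid_iteration =
  fixes C :: "'a::{real_inner, complete_space} set"
    and f :: "'a \<Rightarrow> 'a \<Rightarrow> real"
    and S :: "'a \<Rightarrow> 'a"
    and c1 c2 lam k a :: real
    and \<alpha> :: "nat \<Rightarrow> real"
    and x y z :: "nat \<Rightarrow> 'a"
  assumes closed_C: "closed C" and convex_C: "convex C"
    and monotone: "monotone_bifun_on C f" and diagonal: "\<forall>u\<in>C. f u u = 0"
    and c_pos: "c1 > 0" "c2 > 0" and lipschitz: "lipschitz_type_on C f c1 c2"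
    and weakly_continuous: "weakly_continuous_on C f"
    and convex_subdifferentiable: "\<forall>u\<in>C. convex_on C (f u) \<and> subdifferentiable_on C (f u)"
    and S: "S \<in> C \<rightarrow> C" "nonexpansive_on C S"
    and solutions: "EP f C \<inter> fixed_points C S \<noteq> {}"
    and lam: "0 < lam" "lam < 1 / (2 * (c1 + c2))"
    and k: "k > 1 / (1 - 2 * lam * (c1 + c2))"
    and a: "a < 1"
    and \<alpha>: "\<forall>n. 0 \<le> \<alpha> n \<and> \<alpha> n \<le> a"
    and generated: "hybrid_algorithm C f S c1 c2 lam k \<alpha> x y z"
begin

abbreviation "Sol \<equiv> EP f C \<inter> fixed_points C S"
abbreviation "eps \<equiv> hybrid_eps c1 c2 lam k x y"
abbreviation "\<Omega> n \<equiv> hybrid_C c1 c2 lam k x y z n \<inter> hybrid_Q x n"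

lemma y_0: "y 0 \<in> C"
  and y_Suc: "y (Suc n) = arg_min_on (\<lambda>v. lam * f (y n) v + 1 / 2 * (norm (x n - v))\<^sup>2) C"
  and z_Suc: "z (Suc n) = \<alpha> n *\<^sub>R y (Suc n) + (1 - \<alpha> n) *\<^sub>R S (y (Suc n))"
  and x_Suc: "x (Suc n) = metric_proj (\<Omega> n) (x 0)"
  using generated unfolding hybrid_algorithm_def by auto

text \<open>
  This is the form in which the conditions on \<open>lam\<close> and \<open>k\<close> enter: in \<open>eps\<close>, the weight of the older
  increment of \<open>y\<close> is less than that of the newer one.
\<close>

lemma k_pos: "0 < k"
  and gap_pos: "2 * lam * c1 < 1 - 1 / k - 2 * lam * c2"
proof -
  have "0 < 1 - 2 * lam * (c1 + c2)"
    using lam c_pos by (simp add: field_simps)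
  moreover from this show "0 < k"
    using k by (meson less_trans zero_less_divide_1_iff)
  ultimately have "1 / k < 1 - 2 * lam * (c1 + c2)"
    using k by (simp add: field_simps)
  then show "2 * lam * c1 < 1 - 1 / k - 2 * lam * c2"
    by (simp add: algebra_simps)
qed

lemma proximal_step:
  assumes "y n \<in> C"
  shows "y (Suc n) \<in> C \<and> (\<forall>v\<in>C. (x n - y (Suc n)) \<bullet> (v - y (Suc n))
      \<le> lam * f (y n) v - lam * f (y n) (y (Suc n)))"
proof -
  let ?g = "\<lambda>v. lam * f (y n) v"
  let ?h = "\<lambda>v. lam * f (y n) v + 1 / 2 * (norm (x n - v))\<^sup>2"
  have conv: "convex_on C ?g"
    using convex_subdifferentiable assms lam by (intro convex_on_cmul) auto
  have cont: "continuous_on C ?g"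
    using weakly_continuous_on_continuous[OF weakly_continuous assms] by (intro continuous_intros)
  obtain w where w: "w \<in> subdifferential C (f (y n)) (y n)"
    using convex_subdifferentiable assms unfolding subdifferentiable_on_def by blast
  have "lam * (f (y n) (y n) - w \<bullet> y n) + (lam *\<^sub>R w) \<bullet> v \<le> lam * f (y n) v" if "v \<in> C" for v
  proof -
    have "w \<bullet> v - w \<bullet> y n \<le> f (y n) v - f (y n) (y n)"
      using w that unfolding subdifferential_def by (auto simp: inner_diff_right)
    then have "lam * (w \<bullet> v - w \<bullet> y n) \<le> lam * (f (y n) v - f (y n) (y n))"
      using lam by simp
    then show ?thesis
      by (simp add: algebra_simps)
  qed
  then obtain m where m: "m \<in> C" "\<forall>v\<in>C. ?h m \<le> ?h v"
    using proximal_point_exists[OF _ closed_C convex_C conv cont, of _ _ "x n"] assms by blast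
  then have "is_arg_min ?h (\<lambda>v. v \<in> C) m"
    unfolding is_arg_min_def by (auto simp: not_less)
  then have "is_arg_min ?h (\<lambda>v. v \<in> C) (y (Suc n))"
    unfolding y_Suc arg_min_on_def arg_min_def by (rule someI)
  then have y: "y (Suc n) \<in> C" "\<And>v. v \<in> C \<Longrightarrow> ?h (y (Suc n)) \<le> ?h v"
    unfolding is_arg_min_def by (auto simp: not_less)
  then show ?thesis
    using proximal_point_variational[OF convex_C conv y] by blast
qed

lemma y_in: "y n \<in> C"
  by (induction n) (use y_0 proximal_step in auto)

lemma y_variational:
  "v \<in> C \<Longrightarrow> (x n - y (Suc n)) \<bullet> (v - y (Suc n)) \<le> lam * f (y n) v - lam * f (y n) (y (Suc n))"
  using proximal_step[OF y_in] by blast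

text \<open>
  Optimality of \<open>y (Suc n)\<close> tested at \<open>y (Suc (Suc n))\<close> bounds from below the difference of the two
  values of \<open>f (y n)\<close> that the Lipschitz-type condition leaves behind.  The estimate serves twice:
  for the half-spaces \<open>hybrid_C\<close>, and to show that \<open>f (y n) v\<close> is asymptotically nonnegative.
\<close>

lemma f_increment_lower:
  "(x n - y (Suc n)) \<bullet> (y (Suc (Suc n)) - y (Suc n)) - lam * c1 * (norm (y (Suc n) - y n))\<^sup>2
     - lam * c2 * (norm (y (Suc (Suc n)) - y (Suc n)))\<^sup>2
   \<le> lam * f (y (Suc n)) (y (Suc (Suc n)))"
proof -
  have "f (y n) (y (Suc (Suc n))) - c1 * (norm (y n - y (Suc n)))\<^sup>2
      - c2 * (norm (y (Suc n) - y (Suc (Suc n))))\<^sup>2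
      \<le> f (y n) (y (Suc n)) + f (y (Suc n)) (y (Suc (Suc n)))"
    using lipschitz y_in unfolding lipschitz_type_on_def by blast
  from mult_left_mono[OF this, of lam] lam
  have "lam * f (y n) (y (Suc (Suc n))) - lam * f (y n) (y (Suc n))
      - lam * c1 * (norm (y (Suc n) - y n))\<^sup>2 - lam * c2 * (norm (y (Suc (Suc n)) - y (Suc n)))\<^sup>2
      \<le> lam * f (y (Suc n)) (y (Suc (Suc n)))"
    by (simp add: algebra_simps norm_minus_commute)
  with y_variational[OF y_in, of n "Suc (Suc n)"] show ?thesis
    by linarith
qed

text \<open>
  Optimality of \<open>y (Suc (Suc n))\<close> tested at \<open>p\<close>, where \<open>f (y (Suc n)) p\<close> is nonpositive by
  monotonicity, leaves the value of \<open>f\<close> at two consecutive iterates, which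
  \<open>f_increment_lower\<close> estimates.  The inner products then combine to one with
  \<open>x (Suc n) - x n\<close>, and Young's inequality with parameter \<open>k\<close> splits it into the terms
  of \<open>eps\<close> that involve \<open>k\<close>.
\<close>

lemma y_step_solution:
  assumes p: "p \<in> EP f C"
  shows "(norm (y (Suc (Suc n)) - p))\<^sup>2 \<le> (norm (x (Suc n) - p))\<^sup>2 + eps (Suc n)"
proof -
  define u v where "u = y (Suc n)" and "v = y (Suc (Suc n))"
  have pC: "p \<in> C" and "0 \<le> f p u"
    using p y_in unfolding EP_def u_def by auto
  moreover have "f u p + f p u \<le> 0"
    using monotone pC y_in unfolding monotone_bifun_on_def u_def by blast
  ultimately have "lam * f u p \<le> 0"
    using lam by (simp add: mult_nonneg_nonpos)
  then have 1: "(x (Suc n) - v) \<bullet> (p - v) \<le> - lam * f u v"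
    using y_variational[OF pC, of "Suc n"] unfolding u_def v_def by simp
  have 2: "(x n - u) \<bullet> (v - u) - lam * c1 * (norm (u - y n))\<^sup>2 - lam * c2 * (norm (v - u))\<^sup>2
      \<le> lam * f u v"
    using f_increment_lower unfolding u_def v_def by blast
  have 3: "2 * ((x (Suc n) - x n) \<bullet> (v - u))
      \<le> k * (norm (x (Suc n) - x n))\<^sup>2 + 1 / k * (norm (v - u))\<^sup>2"
    using k_pos by (rule inner_Young)
  have "(norm (v - p))\<^sup>2 = (norm (x (Suc n) - p))\<^sup>2 + 2 * ((x (Suc n) - v) \<bullet> (p - v))
      - (norm (x (Suc n) - v))\<^sup>2"
    unfolding power2_norm_eq_inner by (simp add: inner_diff_left inner_diff_right inner_commute)
  moreover have "(norm (x (Suc n) - v))\<^sup>2 = (norm (x (Suc n) - u))\<^sup>2 + (norm (v - u))\<^sup>2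
      - 2 * ((x (Suc n) - x n) \<bullet> (v - u)) - 2 * ((x n - u) \<bullet> (v - u))"
    unfolding power2_norm_eq_inner by (simp add: inner_diff_left inner_diff_right inner_commute)
  moreover have "eps (Suc n) = k * (norm (x (Suc n) - x n))\<^sup>2 + 2 * (lam * c1 * (norm (u - y n))\<^sup>2)
      - (norm (v - u))\<^sup>2 + 1 / k * (norm (v - u))\<^sup>2 + 2 * (lam * c2 * (norm (v - u))\<^sup>2)"
    unfolding hybrid_eps_def u_def v_def by (simp add: algebra_simps)
  ultimately show ?thesis
    using 1 2 3 zero_le_power2[of "norm (x (Suc n) - u)"] unfolding u_def v_def by linarith
qed

lemma z_dist_fixed_point:
  assumes p: "p \<in> fixed_points C S"
  shows "norm (z (Suc n) - p) \<le> norm (y (Suc n) - p)"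
proof -
  have \<alpha>n: "0 \<le> \<alpha> n" "\<alpha> n \<le> 1"
    using \<alpha> a by (meson less_imp_le order_trans)+
  have "p \<in> C" "S p = p"
    using p unfolding fixed_points_def by auto
  moreover from this have "norm (S (y (Suc n)) - S p) \<le> norm (y (Suc n) - p)"
    using S(2) y_in unfolding nonexpansive_on_def by blast
  ultimately have Sy: "norm (S (y (Suc n)) - p) \<le> norm (y (Suc n) - p)"
    by simp
  have "z (Suc n) - p = \<alpha> n *\<^sub>R (y (Suc n) - p) + (1 - \<alpha> n) *\<^sub>R (S (y (Suc n)) - p)"
    unfolding z_Suc by (simp add: algebra_simps)
  also have "norm \<dots> \<le> \<alpha> n * norm (y (Suc n) - p) + (1 - \<alpha> n) * norm (S (y (Suc n)) - p)"
    using \<alpha>n by (intro norm_triangle_le) simp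
  also have "\<dots> \<le> norm (y (Suc n) - p)"
    using \<alpha>n Sy by (intro convex_bound_le) auto
  finally show ?thesis .
qed

lemma Sol_subset_C: "Sol \<subseteq> hybrid_C c1 c2 lam k x y z n"
proof
  fix p assume p: "p \<in> Sol"
  show "p \<in> hybrid_C c1 c2 lam k x y z n"
  proof (cases n)
    case 0
    then show ?thesis
      by (simp add: hybrid_C_def)
  next
    case (Suc m)
    have y: "(norm (y (Suc n) - p))\<^sup>2 \<le> (norm (x n - p))\<^sup>2 + eps n"
      using y_step_solution p Suc by blast
    have "(norm (z (Suc n) - p))\<^sup>2 \<le> (norm (y (Suc n) - p))\<^sup>2"
      using z_dist_fixed_point p by (intro power_mono) auto
    from order_trans[OF this y] y Suc show ?thesis
      unfolding hybrid_C_def farther_point_def by simp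
  qed
qed

text \<open>
  The squared norms of the variable point cancel in the condition defining \<open>hybrid_C\<close>, which is
  therefore affine.
\<close>

lemma closed_convex_\<Omega>: "closed (\<Omega> n)" "convex (\<Omega> n)"
proof -
  have Q: "hybrid_Q x n = (if n = 0 then UNIV else {p. (x 0 - x n) \<bullet> p \<le> (x 0 - x n) \<bullet> x n})"
    unfolding hybrid_Q_def by (simp add: inner_diff_right)
  let ?w = "farther_point (x n) (y (Suc n)) (z (Suc n))"
  have "(norm (?w - p))\<^sup>2 \<le> (norm (x n - p))\<^sup>2 + eps n
      \<longleftrightarrow> (x n - ?w) \<bullet> p \<le> ((norm (x n))\<^sup>2 - (norm ?w)\<^sup>2 + eps n) / 2" for p
    unfolding power2_norm_eq_inner
    by (simp add: inner_diff_left inner_diff_right inner_commute field_simps)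
  then have "hybrid_C c1 c2 lam k x y z n = (if n = 0 then UNIV
      else {p. (x n - ?w) \<bullet> p \<le> ((norm (x n))\<^sup>2 - (norm ?w)\<^sup>2 + eps n) / 2})"
    unfolding hybrid_C_def by presburger
  then obtain h b where HC: "hybrid_C c1 c2 lam k x y z n = (if n = 0 then UNIV else {p. h \<bullet> p \<le> b})"
    by blast
  show "closed (\<Omega> n)"
    unfolding Q HC by (auto intro!: closed_Int closed_halfspace_le)
  show "convex (\<Omega> n)"
    unfolding Q HC by (auto intro!: convex_Int convex_halfspace_le)
qed

lemma Sol_subset_Q: "Sol \<subseteq> hybrid_Q x n"
proof (induction n)
  case 0
  then show ?case
    by (simp add: hybrid_Q_def)
next
  case (Suc n)
  have "Sol \<subseteq> \<Omega> n"
    using Suc Sol_subset_C by blast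
  moreover have "(x 0 - x (Suc n)) \<bullet> (p - x (Suc n)) \<le> 0" if "p \<in> \<Omega> n" for p
    unfolding x_Suc using that by (intro metric_proj_variational closed_convex_\<Omega>) auto
  ultimately show ?case
    unfolding hybrid_Q_def by auto
qed

lemma x_Suc_in: "x (Suc n) \<in> \<Omega> n"
proof -
  have "\<Omega> n \<noteq> {}"
    using Sol_subset_C Sol_subset_Q solutions by blast
  then show ?thesis
    unfolding x_Suc by (intro metric_proj_in closed_convex_\<Omega>)
qed

lemma hybrid_Q_variational:
  assumes "q \<in> hybrid_Q x n"
  shows "(x 0 - x n) \<bullet> (q - x n) \<le> 0"
  using assms unfolding hybrid_Q_def by (auto split: if_splits)

lemma dist_x_Sol:
  assumes "p \<in> Sol"
  shows "(norm (p - x n))\<^sup>2 \<le> (norm (p - x 0))\<^sup>2 - (norm (x n - x 0))\<^sup>2"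
  using assms Sol_subset_Q by (intro dist_power2_variational hybrid_Q_variational) blast

lemma x_increment:
  "(norm (x (Suc n) - x n))\<^sup>2 \<le> (norm (x (Suc n) - x 0))\<^sup>2 - (norm (x n - x 0))\<^sup>2"
  using x_Suc_in by (intro dist_power2_variational hybrid_Q_variational) blast

lemma x_dist_bound:
  assumes "p \<in> Sol"
  shows "norm (x n - x 0) \<le> norm (p - x 0)"
proof (rule power2_le_imp_le)
  show "(norm (x n - x 0))\<^sup>2 \<le> (norm (p - x 0))\<^sup>2"
    using dist_x_Sol[OF assms, of n] zero_le_power2[of "norm (p - x n)"] by linarith
qed simp

lemma x_dist_convergent: "convergent (\<lambda>n. norm (x n - x 0))"
proof -
  obtain p where p: "p \<in> Sol"
    using solutions by blast
  have "incseq (\<lambda>n. norm (x n - x 0))"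
  proof (rule incseq_SucI, rule power2_le_imp_le)
    show "(norm (x n - x 0))\<^sup>2 \<le> (norm (x (Suc n) - x 0))\<^sup>2" for n
      using x_increment[of n] zero_le_power2[of "norm (x (Suc n) - x n)"] by linarith
  qed simp
  then show ?thesis
    using x_dist_bound[OF p] by (meson incseq_convergent convergentI)
qed

lemma x_increment_tendsto: "(\<lambda>n. x (Suc n) - x n) \<longlonglongrightarrow> 0"
proof -
  obtain d where d: "(\<lambda>n. norm (x n - x 0)) \<longlonglongrightarrow> d"
    using x_dist_convergent convergent_def by blast
  have "(\<lambda>n. (norm (x (Suc n) - x 0))\<^sup>2 - (norm (x n - x 0))\<^sup>2) \<longlonglongrightarrow> d\<^sup>2 - d\<^sup>2"
    by (intro tendsto_intros d LIMSEQ_Suc[OF d])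
  then have "(\<lambda>n. (norm (x (Suc n) - x 0))\<^sup>2 - (norm (x n - x 0))\<^sup>2) \<longlonglongrightarrow> 0"
    by simp
  then show ?thesis
    using x_increment by (rule tendsto_zero_norm_power2_le)
qed

text \<open>
  This is the membership of the next iterate in its own half-space, and all asymptotic regularity
  comes from it: its left-hand side is nonnegative, which controls the increments of \<open>y\<close>, and these
  in turn make its right-hand side vanish in the limit.
\<close>

lemma farther_dist_x:
  "(norm (farther_point (x (Suc n)) (y (Suc (Suc n))) (z (Suc (Suc n))) - x (Suc (Suc n))))\<^sup>2
   \<le> (norm (x (Suc (Suc n)) - x (Suc n)))\<^sup>2 + eps (Suc n)"
  using x_Suc_in[of "Suc n"] by (simp add: hybrid_C_def norm_minus_commute[of "x (Suc n)"])

lemma eps_Suc: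
  "eps (Suc n) = k * (norm (x (Suc n) - x n))\<^sup>2 + 2 * lam * c1 * (norm (y (Suc n) - y n))\<^sup>2
     - (1 - 1 / k - 2 * lam * c2) * (norm (y (Suc (Suc n)) - y (Suc n)))\<^sup>2"
  by (simp add: hybrid_eps_def)

lemma y_increment_tendsto: "(\<lambda>n. y (Suc n) - y n) \<longlonglongrightarrow> 0"
proof -
  define b c where "b = 2 * lam * c1" and "c = 1 - 1 / k - 2 * lam * c2"
  have bc: "0 < b" "b < c"
    using lam c_pos gap_pos unfolding b_def c_def by auto
  define A where "A n = (norm (y (Suc n) - y n))\<^sup>2" for n
  define X where "X n = (norm (x (Suc n) - x n))\<^sup>2" for n
  have X: "X \<longlonglongrightarrow> 0"
    unfolding X_def using x_increment_tendsto by (simp only: tendsto_zero_norm_power2)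
  have "A \<longlonglongrightarrow> 0"
  proof (rule perturbed_contraction_tendsto_zero)
    show "0 \<le> b / c" "b / c < 1"
      using bc by auto
    show "A (Suc n) \<le> b / c * A n + (X (Suc n) + k * X n) / c" for n
    proof -
      have "c * A (Suc n) \<le> b * A n + (X (Suc n) + k * X n)"
        using order_trans[OF zero_le_power2 farther_dist_x[of n]]
        unfolding eps_Suc A_def X_def b_def c_def by linarith
      then show ?thesis
        using bc by (simp add: field_simps)
    qed
    have "(\<lambda>n. (X (Suc n) + k * X n) / c) \<longlonglongrightarrow> (0 + k * 0) / c"
      by (intro tendsto_intros X LIMSEQ_Suc[OF X]) (use bc in auto)
    then show "(\<lambda>n. (X (Suc n) + k * X n) / c) \<longlonglongrightarrow> 0"
      by simp
  qed (simp add: A_def)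
  then show ?thesis
    unfolding A_def by (simp only: tendsto_zero_norm_power2)
qed

lemma farther_x_tendsto:
  "(\<lambda>n. farther_point (x (Suc n)) (y (Suc (Suc n))) (z (Suc (Suc n))) - x (Suc n)) \<longlonglongrightarrow> 0"
proof -
  let ?w = "\<lambda>n. farther_point (x (Suc n)) (y (Suc (Suc n))) (z (Suc (Suc n)))"
  have X: "(\<lambda>n. (norm (x (Suc n) - x n))\<^sup>2) \<longlonglongrightarrow> 0"
    using x_increment_tendsto by (simp only: tendsto_zero_norm_power2)
  have A: "(\<lambda>n. (norm (y (Suc n) - y n))\<^sup>2) \<longlonglongrightarrow> 0"
    using y_increment_tendsto by (simp only: tendsto_zero_norm_power2)
  have "(\<lambda>n. (norm (x (Suc (Suc n)) - x (Suc n)))\<^sup>2 + eps (Suc n)) \<longlonglongrightarrow>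
      0 + (k * 0 + 2 * lam * c1 * 0 - (1 - 1 / k - 2 * lam * c2) * 0)"
    unfolding eps_Suc by (intro tendsto_intros X A LIMSEQ_Suc[OF X] LIMSEQ_Suc[OF A])
  then have "(\<lambda>n. (norm (x (Suc (Suc n)) - x (Suc n)))\<^sup>2 + eps (Suc n)) \<longlonglongrightarrow> 0"
    by simp
  then have "(\<lambda>n. ?w n - x (Suc (Suc n))) \<longlonglongrightarrow> 0"
    using farther_dist_x by (rule tendsto_zero_norm_power2_le)
  from tendsto_add[OF this LIMSEQ_Suc[OF x_increment_tendsto]] show ?thesis
    by simp
qed

text \<open>
  Both \<open>y\<close> and \<open>z\<close> are controlled because the half-space is built from the one farther from \<open>x\<close>.
\<close>

lemma yz_tendsto_x:
  "(\<lambda>n. y n - x n) \<longlonglongrightarrow> 0" "(\<lambda>n. z n - x n) \<longlonglongrightarrow> 0"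
proof -
  let ?w = "\<lambda>n. farther_point (x (Suc n)) (y (Suc (Suc n))) (z (Suc (Suc n)))"
  have lim: "(\<lambda>n. t n - x n) \<longlonglongrightarrow> 0"
    if t: "\<And>n. norm (t (Suc (Suc n)) - x (Suc n)) \<le> norm (?w n - x (Suc n))" for t :: "nat \<Rightarrow> 'a"
  proof -
    have "(\<lambda>n. t (Suc (Suc n)) - x (Suc n)) \<longlonglongrightarrow> 0"
      using tendsto_norm_zero[OF farther_x_tendsto] t by (rule tendsto_zero_norm_le)
    from tendsto_diff[OF this LIMSEQ_Suc[OF x_increment_tendsto]]
    have "(\<lambda>n. t (Suc (Suc n)) - x (Suc (Suc n))) \<longlonglongrightarrow> 0"
      by simp
    then have "(\<lambda>n. t (Suc n) - x (Suc n)) \<longlonglongrightarrow> 0"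
      by (rule LIMSEQ_imp_Suc)
    then show ?thesis
      by (rule LIMSEQ_imp_Suc)
  qed
  show "(\<lambda>n. y n - x n) \<longlonglongrightarrow> 0" "(\<lambda>n. z n - x n) \<longlonglongrightarrow> 0"
    by (rule lim, simp add: farther_point_def)+
qed

text \<open>
  The step from \<open>y\<close> to \<open>z\<close> moves at least the fraction \<open>1 - a\<close> of the displacement under \<open>S\<close>.
\<close>

lemma y_displacement_tendsto: "(\<lambda>n. y n - S (y n)) \<longlonglongrightarrow> 0"
proof (rule LIMSEQ_imp_Suc)
  have "(\<lambda>n. z n - y n) \<longlonglongrightarrow> 0"
    using tendsto_diff[OF yz_tendsto_x(2) yz_tendsto_x(1)] by simp
  then have zy: "(\<lambda>n. norm (z (Suc n) - y (Suc n))) \<longlonglongrightarrow> 0"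
    using LIMSEQ_Suc tendsto_norm_zero by blast
  have le: "norm (y (Suc n) - S (y (Suc n))) \<le> norm (z (Suc n) - y (Suc n)) / (1 - a)" for n
  proof -
    have "z (Suc n) - y (Suc n) = (1 - \<alpha> n) *\<^sub>R (S (y (Suc n)) - y (Suc n))"
      unfolding z_Suc by (simp add: algebra_simps)
    moreover have "1 - a \<le> \<bar>1 - \<alpha> n\<bar>"
      using \<alpha>[rule_format, of n] by linarith
    ultimately have "(1 - a) * norm (y (Suc n) - S (y (Suc n))) \<le> norm (z (Suc n) - y (Suc n))"
      by (simp add: mult_right_mono norm_minus_commute)
    then show ?thesis
      using a by (simp add: field_simps)
  qed
  have "(\<lambda>n. norm (z (Suc n) - y (Suc n)) / (1 - a)) \<longlonglongrightarrow> 0"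
    using tendsto_divide[OF zy tendsto_const[of "1 - a"]] a by simp
  then show "(\<lambda>n. y (Suc n) - S (y (Suc n))) \<longlonglongrightarrow> 0"
    using le by (rule tendsto_zero_norm_le)
qed

lemma bounded_y: "bounded (range y)"
proof -
  obtain p where p: "p \<in> Sol"
    using solutions by blast
  have "range x \<subseteq> cball (x 0) (norm (p - x 0))"
    using x_dist_bound[OF p] by (auto simp: dist_norm norm_minus_commute)
  then have "bounded (range x)"
    using bounded_subset bounded_cball by blast
  moreover have "bounded (range (\<lambda>n. y n - x n))"
    using yz_tendsto_x(1) by (rule convergent_imp_bounded)
  ultimately show ?thesis
    using bounded_plus_comp[of x UNIV "\<lambda>n. y n - x n"] by simp
qed

text \<open>
  Optimality of the proximal steps makes \<open>f (y n) v\<close> asymptotically nonnegative, hence by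
  monotonicity \<open>f v (y n)\<close> asymptotically nonpositive; the latter is convex in \<open>y n\<close>, so the bound
  is inherited by \<open>p\<close>.
\<close>

lemma tail_point_in_EP:
  assumes p: "\<And>n. p \<in> closure (convex hull (y ` {n..}))"
  shows "p \<in> EP f C"
proof (rule EP_MintyI[OF convex_C _ diagonal _ weakly_continuous])
  show conv: "convex_on C (f v)" if "v \<in> C" for v
    using convex_subdifferentiable that by blast
  have cont: "continuous_on C (f v)" if "v \<in> C" for v
    using weakly_continuous_on_continuous[OF weakly_continuous that] .
  show "f v p \<le> 0" if v: "v \<in> C" for v
  proof -
    \<comment> \<open>The bound on \<open>f v (y n)\<close> involves the step before \<open>n\<close>, so it is established from index 1 on.\<close>
    define t where "t n = - (1 / lam) * ((x n - y (Suc n)) \<bullet> (v - y (Suc n))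
        + ((x (n - 1) - y n) \<bullet> (y (Suc n) - y n) - lam * c1 * (norm (y n - y (n - 1)))\<^sup>2
        - lam * c2 * (norm (y (Suc n) - y n))\<^sup>2))" for n
    have t_ge: "f v (y (Suc n)) \<le> t (Suc n)" for n
    proof -
      let ?u = "y (Suc n)"
      let ?l = "(x (Suc n) - y (Suc (Suc n))) \<bullet> (v - y (Suc (Suc n)))
        + ((x n - y (Suc n)) \<bullet> (y (Suc (Suc n)) - y (Suc n)) - lam * c1 * (norm (y (Suc n) - y n))\<^sup>2
        - lam * c2 * (norm (y (Suc (Suc n)) - y (Suc n)))\<^sup>2)"
      have "?l \<le> lam * f ?u v"
        using y_variational[OF v, of "Suc n"] f_increment_lower[of n] by linarith
      then have "(1 / lam) * ?l \<le> f ?u v"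
        using lam by (simp add: divide_le_eq mult.commute)
      moreover have "f ?u v + f v ?u \<le> 0"
        using monotone v y_in unfolding monotone_bifun_on_def by blast
      moreover have "t (Suc n) = - ((1 / lam) * ?l)"
        unfolding t_def by simp
      ultimately show ?thesis
        by linarith
    qed
    have xy: "(\<lambda>n. x n - y (Suc n)) \<longlonglongrightarrow> 0"
      using tendsto_minus[OF tendsto_add[OF yz_tendsto_x(1) y_increment_tendsto]] by simp
    have A: "(\<lambda>n. (norm (y (Suc n) - y n))\<^sup>2) \<longlonglongrightarrow> 0"
      using y_increment_tendsto by (simp only: tendsto_zero_norm_power2)
    have "bounded ((\<lambda>n. v - y n) ` UNIV)"
      using bounded_y by (intro bounded_minus_comp) auto
    then have bdd: "bounded (range (\<lambda>n. v - y (Suc (Suc n))))"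
      by (rule bounded_subset) auto
    have bdd_increment: "bounded (range (\<lambda>n. y (Suc (Suc n)) - y (Suc n)))"
      by (rule convergent_imp_bounded[OF LIMSEQ_Suc[OF y_increment_tendsto]])
    have "(\<lambda>n. t (Suc n)) \<longlonglongrightarrow> - (1 / lam) * (0 + (0 - lam * c1 * 0 - lam * c2 * 0))"
      unfolding t_def diff_Suc_1
      by (intro tendsto_intros tendsto_zero_inner_bounded bdd bdd_increment LIMSEQ_Suc[OF xy] xy A
          LIMSEQ_Suc[OF A])
    then have "t \<longlonglongrightarrow> 0"
      by (intro LIMSEQ_imp_Suc[of t]) simp
    moreover have "\<forall>\<^sub>F n in sequentially. f v (y n) \<le> t n"
      using t_ge eventually_sequentially_Suc[of "\<lambda>n. f v (y n) \<le> t n"] by simp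
    ultimately show ?thesis
      using tail_hulls_convex_bound[OF p closed_C y_in conv[OF v] cont[OF v]] by blast
  qed
  show "p \<in> C"
    using closed_C convex_C y_in by (rule tail_hulls_in[OF p])
qed

text \<open>
  Monotonicity of the displacement replaces \<open>y n - S (y n)\<close>, which tends to zero, by the
  displacement at a fixed \<open>v\<close>; the resulting bound is affine in \<open>y n\<close>.
\<close>

lemma tail_point_in_fixed_points:
  assumes p: "\<And>n. p \<in> closure (convex hull (y ` {n..}))"
  shows "p \<in> fixed_points C S"
proof (rule fixed_points_MintyI[OF convex_C _ S])
  show "p \<in> C"
    using tail_point_in_EP[OF p] unfolding EP_def by blast
  fix v assume v: "v \<in> C"
  let ?g = "\<lambda>u. (v - S v) \<bullet> (u - v)"
  have conv: "convex_on C ?g"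
  proof (rule convex_onI)
    fix t :: real and u w
    assume "0 < t" "t < 1" "u \<in> C" "w \<in> C"
    have "(1 - t) *\<^sub>R u + t *\<^sub>R w - v = (1 - t) *\<^sub>R (u - v) + t *\<^sub>R (w - v)"
      by (simp add: algebra_simps)
    then show "?g ((1 - t) *\<^sub>R u + t *\<^sub>R w) \<le> (1 - t) * ?g u + t * ?g w"
      by (simp only: inner_add_right inner_scaleR_right)
  qed (rule convex_C)
  have cont: "continuous_on C ?g"
    by (intro continuous_intros)
  have le: "?g (y n) \<le> (y n - S (y n)) \<bullet> (y n - v)" for n
    using nonexpansive_on_monotone_displacement[OF S(2) y_in[of n] v]
    by (simp add: inner_diff_right)
  have lim: "(\<lambda>n. (y n - S (y n)) \<bullet> (y n - v)) \<longlonglongrightarrow> 0"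
    using bounded_y by (intro tendsto_zero_inner_bounded y_displacement_tendsto bounded_minus_comp) auto
  have "?g p \<le> 0"
    by (rule tail_hulls_convex_bound[OF p closed_C y_in conv cont always_eventually lim])
      (use le in blast)
  then show "0 \<le> (v - S v) \<bullet> (v - p)"
    by (simp add: inner_diff_right)
qed

text \<open>
  The common point \<open>p\<close> of the tail hulls has distance at most \<open>lim \<parallel>x\<^sub>n - x\<^sub>0\<parallel>\<close> from \<open>x\<^sub>0\<close>, being a limit
  of convex combinations of points whose distances have that limit, and at least that distance,
  being a solution.  Equality turns \<open>dist_x_Sol\<close> into convergence, and the inequalities defining the
  sets \<open>hybrid_Q\<close>, which hold for every solution, pass to the limit and identify \<open>p\<close> as the
  projection.
\<close>

theorem strong_convergence:
  "x \<longlonglongrightarrow> metric_proj Sol (x 0)"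
  "y \<longlonglongrightarrow> metric_proj Sol (x 0)"
  "z \<longlonglongrightarrow> metric_proj Sol (x 0)"
proof -
  obtain p where p: "\<And>n. p \<in> closure (convex hull (y ` {n..}))"
    using tail_hulls_common_point[OF bounded_y] by blast
  have Sol: "p \<in> Sol"
    using tail_point_in_EP[OF p] tail_point_in_fixed_points[OF p] by blast
  obtain d where d: "(\<lambda>n. norm (x n - x 0)) \<longlonglongrightarrow> d"
    using x_dist_convergent convergent_def by blast
  have "dist (x 0) p \<le> d"
  proof (rule tail_hulls_convex_bound[OF p closed_UNIV _ _ _ always_eventually])
    show "convex_on UNIV (dist (x 0))"
      by (simp add: convex_on_dist)
    show "\<forall>n. dist (x 0) (y n) \<le> norm (x n - x 0) + norm (y n - x n)"
      by (metis dist_commute dist_norm dist_triangle)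
    show "(\<lambda>n. norm (x n - x 0) + norm (y n - x n)) \<longlonglongrightarrow> d"
      using tendsto_add[OF d tendsto_norm_zero[OF yz_tendsto_x(1)]] by simp
  qed (auto intro: continuous_intros)
  moreover have "d \<le> norm (p - x 0)"
    using LIMSEQ_le_const2[OF d] x_dist_bound[OF Sol] by blast
  ultimately have d_eq: "norm (p - x 0) = d"
    by (simp add: dist_norm norm_minus_commute)
  have "(\<lambda>n. (norm (p - x 0))\<^sup>2 - (norm (x n - x 0))\<^sup>2) \<longlonglongrightarrow> d\<^sup>2 - d\<^sup>2"
    unfolding d_eq by (intro tendsto_intros d)
  then have "(\<lambda>n. (norm (p - x 0))\<^sup>2 - (norm (x n - x 0))\<^sup>2) \<longlonglongrightarrow> 0"
    by simp
  then have "(\<lambda>n. p - x n) \<longlonglongrightarrow> 0"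
    using dist_x_Sol[OF Sol] by (rule tendsto_zero_norm_power2_le)
  from tendsto_diff[OF tendsto_const[of p] this] have x: "x \<longlonglongrightarrow> p"
    by simp
  have "metric_proj Sol (x 0) = p"
  proof (rule metric_proj_eqI[OF Sol])
    fix q assume "q \<in> Sol"
    then have "(x 0 - x n) \<bullet> (q - x n) \<le> 0" for n
      using Sol_subset_Q hybrid_Q_variational by blast
    moreover have "(\<lambda>n. (x 0 - x n) \<bullet> (q - x n)) \<longlonglongrightarrow> (x 0 - p) \<bullet> (q - p)"
      by (intro tendsto_intros x)
    ultimately show "(x 0 - p) \<bullet> (q - p) \<le> 0"
      by (meson LIMSEQ_le_const2)
  qed
  then show "x \<longlonglongrightarrow> metric_proj Sol (x 0)" "y \<longlonglongrightarrow> metric_proj Sol (x 0)" "z \<longlonglongrightarrow> metric_proj Sol (x 0)"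
    using x tendsto_add[OF yz_tendsto_x(1) x] tendsto_add[OF yz_tendsto_x(2) x] by simp_all
qed

end

theorem theorem1:
  fixes C :: "'a::{real_inner, complete_space} set"
    and f :: "'a \<Rightarrow> 'a \<Rightarrow> real"
    and S :: "'a \<Rightarrow> 'a"
    and c1 c2 lam k a :: real
    and \<alpha> :: "nat \<Rightarrow> real"
    and x y z :: "nat \<Rightarrow> 'a"
  assumes "C \<noteq> {}" and "closed C" and "convex C"
    and A1: "monotone_bifun_on C f" "\<forall>u\<in>C. f u u = 0"
    and A2: "c1 > 0" "c2 > 0" "lipschitz_type_on C f c1 c2"
    and A3: "weakly_continuous_on C f"
    and A4: "\<forall>u\<in>C. convex_on C (f u) \<and> subdifferentiable_on C (f u)"
    and S: "S \<in> C \<rightarrow> C" "nonexpansive_on C S"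
    and solutions: "EP f C \<inter> fixed_points C S \<noteq> {}"
    and lam: "0 < lam" "lam < 1 / (2 * (c1 + c2))"
    and k: "k > 1 / (1 - 2 * lam * (c1 + c2))"
    and a: "0 < a" "a < 1"
    and \<alpha>: "\<forall>n. 0 \<le> \<alpha> n \<and> \<alpha> n \<le> a"
    and generated: "hybrid_algorithm C f S c1 c2 lam k \<alpha> x y z"
  shows "x \<longlonglongrightarrow> metric_proj (EP f C \<inter> fixed_points C S) (x 0)
       \<and> y \<longlonglongrightarrow> metric_proj (EP f C \<inter> fixed_points C S) (x 0)
       \<and> z \<longlonglongrightarrow> metric_proj (EP f C \<inter> fixed_points C S) (x 0)"
proof -
  interpret hybrid_iteration C f S c1 c2 lam k a \<alpha> x y z
    using assms by unfold_locales auto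
  show ?thesis
    using strong_convergence by blast
qed

end
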